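(* Let $\Lambda=(\Lambda_1,\dots,\Lambda_n)$ be an admissible minimally stable configuration of weights in $\mathbb C^m$, with visible complex $K$. For every integer $r$ with $$\left\lceil\frac m2\right\rceil\le r\le m$$ there is an admissible minimally stable configuration $\Lambda^{(r)}=(\Lambda^{(r)}_1,\dots,\Lambda^{(r)}_n)$ in $\mathbb C^m$ such that: for every subset $I\subseteq\{1,\dots,n\}$, $0\in\operatorname{conv}\{\Lambda^{(r)}_i:i\in I\}$ if and only if $0\in\operatorname{conv}\{\Lambda_i:i\in I\}$ (hence $\Lambda^{(r)}$ has the same indispensable set and the same visible complex $K$ as $\Lambda$), and $$\operatorname{rank}_{\mathbb C}B^{(r)}=r,$$ where $B^{(r)}$ is the indispensable block of $\Lambda^{(r)}$. If $\Lambda$ is polytopal, so is $\Lambda^{(r)}$. Thus the set of integers that occur as the complex rank of the indispensable block of an admissible minimally stable configuration in $\mathbb C^m$ is exactly $\{r:\lceil m/2\rceil\le r\le m\}$, even when the visible complex $K$ is fixed.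
   Context: Convex hulls are taken over $\mathbb R$, with $\mathbb C^m\cong\mathbb R^{2m}$, $m\ge1$; $\langle-,-\rangle$ is the standard complex-bilinear pairing on $\mathbb C^m$. A configuration $\Lambda=(\Lambda_1,\dots,\Lambda_n)$ of vectors in $\mathbb C^m$ is admissible if $0\in\operatorname{conv}(\Lambda_1,\dots,\Lambda_n)$ and $0\notin\operatorname{conv}\{\Lambda_i:i\in I\}$ for every $I\subseteq\{1,\dots,n\}$ with $1\le|I|\le 2m$. A label $a$ is indispensable if $0\notin\operatorname{conv}\{\Lambda_i:i\ne a\}$; the set of indispensable labels is $D$, and the other labels are called visible. The configuration is minimally stable if $|D|=m+1$; then write $D=\{a_0,a_1,\dots,a_m\}$. The visible complex $K$ is the simplicial complex on the visible labels whose faces are the sets $J$ of visible labels with $0\in\operatorname{conv}\{\Lambda_i:i\notin J\}$ (complement in the full label set). The configuration is polytopal if $K$ is the boundary complex of a simplicial convex polytope of dimension $d=n-2m-1$ whose vertex set is the set of visible labels. The indispensable block $B$ is the $m\times m$ complex matrix with rows $B_\mu(T)=\langle\Lambda_{a_\mu}-\Lambda_{a_0},T\rangle$, $1\le\mu\le m$, $T\in\mathbb C^m$; its rank does not depend on the ordering of $D$. *)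

theory Defs
  imports "HOL-Analysis.Analysis" "HOL-Analysis.Finite_Function_Topology"
begin

text \<open>
  A configuration of \<open>n\<close> vectors in \<open>\<complex>\<^sup>m\<close> is a function \<open>\<Lambda> :: nat \<Rightarrow> complex ^ 'm\<close> of which only
  the values on the labels \<open>{1..n}\<close> matter; \<open>m\<close> is \<open>CARD('m)\<close>.  Since \<open>convex hull\<close> only uses
  \<^const>\<open>scaleR\<close>, hulls in \<open>complex ^ 'm\<close> are real ones.
\<close>

definition admissible :: "nat \<Rightarrow> (nat \<Rightarrow> complex ^ 'm) \<Rightarrow> bool" where
  "admissible n \<Lambda> \<longleftrightarrow>
     0 \<in> convex hull (\<Lambda> ` {1..n}) \<and>
     (\<forall>I \<subseteq> {1..n}. 1 \<le> card I \<and> card I \<le> 2 * CARD('m) \<longrightarrow> 0 \<notin> convex hull (\<Lambda> ` I))"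

definition indispensable :: "nat \<Rightarrow> (nat \<Rightarrow> complex ^ 'm) \<Rightarrow> nat set" where
  "indispensable n \<Lambda> = {a \<in> {1..n}. 0 \<notin> convex hull (\<Lambda> ` ({1..n} - {a}))}"

definition visible :: "nat \<Rightarrow> (nat \<Rightarrow> complex ^ 'm) \<Rightarrow> nat set" where
  "visible n \<Lambda> = {1..n} - indispensable n \<Lambda>"

definition minimally_stable :: "nat \<Rightarrow> (nat \<Rightarrow> complex ^ 'm) \<Rightarrow> bool" where
  "minimally_stable n \<Lambda> \<longleftrightarrow> card (indispensable n \<Lambda>) = CARD('m) + 1"

definition visible_complex :: "nat \<Rightarrow> (nat \<Rightarrow> complex ^ 'm) \<Rightarrow> nat set set" where
  "visible_complex n \<Lambda> =
     {J. J \<subseteq> visible n \<Lambda> \<and> 0 \<in> convex hull (\<Lambda> ` ({1..n} - J))}"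

text \<open>
  The dimension of a polytope varies with \<open>n\<close>, so polytopes are placed in the space
  \<open>nat \<Rightarrow>\<^sub>0 real\<close> of finitely supported real sequences, which contains every \<open>\<real>\<^sup>d\<close>.
  \<^const>\<open>aff_dim\<close> is confined to Euclidean spaces; \<open>has_aff_dim\<close> is its defining property.
\<close>

definition has_aff_dim :: "'a::real_vector set \<Rightarrow> int \<Rightarrow> bool" where
  "has_aff_dim S d \<longleftrightarrow>
     (\<exists>B. finite B \<and> \<not> affine_dependent B \<and> affine hull B = affine hull S \<and> int (card B) = d + 1)"

definition simplicial_polytope :: "'a::real_vector set \<Rightarrow> bool" where
  "simplicial_polytope P \<longleftrightarrow>
     polytope P \<and>
     (\<forall>F. F face_of P \<and> F \<noteq> P \<longrightarrow>
        (\<exists>C. finite C \<and> \<not> affine_dependent C \<and> F = convex hull C))"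

text \<open>
  \<open>K\<close> is the boundary complex of \<open>P\<close>, with the vertices of \<open>P\<close> labelled by \<open>V\<close> through \<open>v\<close>: its
  members are the sets of labels whose vertices span a proper face of \<open>P\<close> (the empty face included).
\<close>

definition boundary_complex_of ::
    "nat set set \<Rightarrow> nat set \<Rightarrow> (nat \<Rightarrow> 'a::real_vector) \<Rightarrow> 'a set \<Rightarrow> bool" where
  "boundary_complex_of K V v P \<longleftrightarrow>
     bij_betw v V {x. x extreme_point_of P} \<and>
     K = {J. J \<subseteq> V \<and> convex hull (v ` J) face_of P \<and> convex hull (v ` J) \<noteq> P}"

definition polytopal :: "nat \<Rightarrow> (nat \<Rightarrow> complex ^ 'm) \<Rightarrow> bool" where
  "polytopal n \<Lambda> \<longleftrightarrow>
     (\<exists>(P :: (nat \<Rightarrow>\<^sub>0 real) set) v.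
        simplicial_polytope P \<and>
        has_aff_dim P (int n - 2 * int CARD('m) - 1) \<and>
        boundary_complex_of (visible_complex n \<Lambda>) (visible n \<Lambda>) v P)"

definition pairing :: "complex ^ 'm \<Rightarrow> complex ^ 'm \<Rightarrow> complex" where
  "pairing z w = (\<Sum>j\<in>UNIV. z $ j * w $ j)"

text \<open>
  An ordering \<open>a\<^sub>0, a\<^sub>1, \<dots>, a\<^sub>m\<close> of the indispensable set: \<open>a None\<close> is \<open>a\<^sub>0\<close>, and the remaining
  elements \<open>a (Some \<mu>)\<close> are indexed by \<open>'m\<close>, which then also indexes the rows of the block.
\<close>

definition orders_indispensable ::
    "nat \<Rightarrow> (nat \<Rightarrow> complex ^ 'm) \<Rightarrow> ('m option \<Rightarrow> nat) \<Rightarrow> bool" where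
  "orders_indispensable n \<Lambda> a \<longleftrightarrow> bij_betw a UNIV (indispensable n \<Lambda>)"

definition indispensable_block ::
    "(nat \<Rightarrow> complex ^ 'm) \<Rightarrow> ('m option \<Rightarrow> nat) \<Rightarrow> complex ^ 'm ^ 'm" where
  "indispensable_block \<Lambda> a = matrix (\<lambda>T. \<chi> \<mu>. pairing (\<Lambda> (a (Some \<mu>)) - \<Lambda> (a None)) T)"

end

theory Submission
  imports Defs
begin

text \<open>
  Real linear automorphisms of \<open>\<complex>\<^sup>m\<close> preserve which subconfigurations have \<open>0\<close> in their hull.
  The rank of the block is the complex dimension spanned by the differences of the indispensable
  weights, and these weights are affinely independent over \<open>\<real>\<close>; so the differences span a real
  space \<open>U\<close> of dimension \<open>m\<close>.  A complex space of dimension \<open>r\<close> has real dimension \<open>2r\<close>, which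
  forces \<open>m \<le> 2r\<close>; conversely, for \<open>m \<le> 2r \<le> 2m\<close>, an automorphism can carry \<open>U\<close> to the real
  span of \<open>e\<^sub>1, \<dots>, e\<^sub>r, \<i>e\<^sub>1, \<dots>, \<i>e\<^bsub>m-r\<^esub>\<close>, whose complex span has dimension \<open>r\<close>.
\<close>

section \<open>Rank of the block and differences of the indispensable weights\<close>

text \<open>Taking all pairs avoids the choice of a base label, and the image under a linear map is
  then again of this form.\<close>

definition differences :: "(nat \<Rightarrow> 'a::ab_group_add) \<Rightarrow> nat set \<Rightarrow> 'a set" where
  "differences \<Lambda> D = {\<Lambda> i - \<Lambda> j | i j. i \<in> D \<and> j \<in> D}"

text \<open>The pairing is bilinear, without conjugation, so evaluating it at the axes reads off the
  coordinates of each weight difference.\<close>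

lemma rows_indispensable_block:
  "rows (indispensable_block \<Lambda> a) = range (\<lambda>\<mu>. \<Lambda> (a (Some \<mu>)) - \<Lambda> (a None))"
proof -
  have "indispensable_block \<Lambda> a $ \<mu> $ j = (\<Lambda> (a (Some \<mu>)) - \<Lambda> (a None)) $ j" for \<mu> j
  proof -
    have "indispensable_block \<Lambda> a $ \<mu> $ j
        = (\<Sum>k\<in>UNIV. (\<Lambda> (a (Some \<mu>)) - \<Lambda> (a None)) $ k * (if k = j then 1 else 0))"
      by (simp add: indispensable_block_def matrix_def pairing_def axis_def)
    also have "\<dots> = (\<Lambda> (a (Some \<mu>)) - \<Lambda> (a None)) $ j"
      by (simp add: if_distrib cong: if_cong)
    finally show ?thesis .
  qed
  then have "row \<mu> (indispensable_block \<Lambda> a) = \<Lambda> (a (Some \<mu>)) - \<Lambda> (a None)" for \<mu>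
    by (simp add: row_def vec_eq_iff)
  then show ?thesis
    by (auto simp: rows_def)
qed

text \<open>Any difference of two weights is a difference of two differences to the base weight, so
  the rows already have the full complex span. The value does not depend on the ordering
  \<open>a\<close>.\<close>

lemma rank_indispensable_block:
  assumes "orders_indispensable n \<Lambda> a"
  shows "rank (indispensable_block \<Lambda> a) = vec.dim (differences \<Lambda> (indispensable n \<Lambda>))"
proof -
  let ?R = "range (\<lambda>\<mu>. \<Lambda> (a (Some \<mu>)) - \<Lambda> (a None))"
  let ?D = "indispensable n \<Lambda>"
  have D: "?D = range a"
    using assms by (simp add: orders_indispensable_def bij_betw_def)
  \<comment> \<open>The case \<open>x = None\<close> gives the zero vector, which puts the base
    label on the same footing as the others.\<close>
  have R: "\<Lambda> (a x) - \<Lambda> (a None) \<in> vec.span ?R" for x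
    by (cases x) (auto simp: vec.span_zero intro: vec.span_base)
  have "differences \<Lambda> ?D \<subseteq> vec.span ?R"
  proof
    fix v assume "v \<in> differences \<Lambda> ?D"
    then obtain x y where "v = \<Lambda> (a x) - \<Lambda> (a y)"
      by (auto simp: differences_def D)
    then have "v = (\<Lambda> (a x) - \<Lambda> (a None)) - (\<Lambda> (a y) - \<Lambda> (a None))"
      by simp
    then show "v \<in> vec.span ?R"
      using vec.span_diff[OF R R] by simp
  qed
  moreover have "?R \<subseteq> differences \<Lambda> ?D"
    by (auto simp: differences_def D)
  ultimately have "vec.dim ?R = vec.dim (differences \<Lambda> ?D)"
    by (meson vec.dim_mono vec.dim_subset le_antisym)
  then show ?thesis
    by (simp add: row_rank_def_gen rows_indispensable_block)
qed

section \<open>Real dimension of the differences\<close>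

text \<open>Translating one of the points to the origin turns affine dimension into linear
  dimension; that point accounts for the summand \<open>1\<close>.\<close>

lemma dim_differences_affine_independent:
  fixes \<Lambda> :: "nat \<Rightarrow> 'a::euclidean_space"
  assumes "finite D" "D \<noteq> {}" "inj_on \<Lambda> D" "\<not> affine_dependent (\<Lambda> ` D)"
  shows "dim (differences \<Lambda> D) + 1 = card D"
proof -
  obtain a where a: "a \<in> D"
    using assms by blast
  let ?R = "(\<lambda>x. x - \<Lambda> a) ` \<Lambda> ` D"
  have "differences \<Lambda> D \<subseteq> span ?R"
  proof
    fix v assume "v \<in> differences \<Lambda> D"
    then obtain i j where ij: "i \<in> D" "j \<in> D" "v = \<Lambda> i - \<Lambda> j"
      by (auto simp: differences_def)
    have "(\<Lambda> i - \<Lambda> a) - (\<Lambda> j - \<Lambda> a) \<in> span ?R"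
      by (intro span_diff span_base) (use ij in auto)
    then show "v \<in> span ?R"
      using ij by simp
  qed
  moreover have "?R \<subseteq> differences \<Lambda> D"
    using a by (auto simp: differences_def)
  ultimately have "dim (differences \<Lambda> D) = dim ?R"
    by (meson dim_mono dim_subset le_antisym)
  moreover have "aff_dim (\<Lambda> ` D) = int (dim ?R)"
    by (rule aff_dim_eq_dim_subtract) (simp add: a hull_inc)
  moreover have "of_nat (card (\<Lambda> ` D)) = aff_dim (\<Lambda> ` D) + 1"
    using assms(4) by (rule aff_dim_affine_independent)
  ultimately show ?thesis
    using assms(3) by (simp add: card_image)
qed

text \<open>
  By Caratheodory, \<open>0\<close> lies in the hull of at most \<open>2m + 1\<close> weights.  Admissibility leaves no
  room for fewer, so these weights are affinely independent; their labels include every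
  indispensable one.
\<close>

lemma affine_independent_indispensable:
  fixes \<Lambda> :: "nat \<Rightarrow> complex ^ 'm"
  assumes "admissible n \<Lambda>"
  shows "inj_on \<Lambda> (indispensable n \<Lambda>) \<and> \<not> affine_dependent (\<Lambda> ` indispensable n \<Lambda>)"
proof -
  have adm: "0 \<in> convex hull (\<Lambda> ` {1..n})"
    "\<And>I. \<lbrakk>I \<subseteq> {1..n}; 1 \<le> card I; card I \<le> 2 * CARD('m)\<rbrakk> \<Longrightarrow> 0 \<notin> convex hull (\<Lambda> ` I)"
    using assms by (auto simp: admissible_def)
  \<comment> \<open>Admissibility restated for sets of vectors: labels chosen injectively are as
    many as the vectors.\<close>
  have large: "2 * CARD('m) < card S"
    if S: "S \<subseteq> \<Lambda> ` {1..n}" "finite S" "0 \<in> convex hull S" for S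
  proof (rule ccontr)
    obtain I where I: "I \<subseteq> {1..n}" "inj_on \<Lambda> I" "S = \<Lambda> ` I"
      using S by (meson subset_image_inj)
    assume "\<not> 2 * CARD('m) < card S"
    moreover have "S \<noteq> {}"
      using S by auto
    ultimately show False
      using adm(2)[of I] S I
      by (metis Suc_leI card_gt_0_iff card_image not_less One_nat_def)
  qed
  obtain S where S: "finite S" "S \<subseteq> \<Lambda> ` {1..n}" "card S \<le> aff_dim (\<Lambda> ` {1..n}) + 1"
    "0 \<in> convex hull S"
    using adm(1) unfolding caratheodory_aff_dim[of "\<Lambda> ` {1..n}"] by blast
  have "aff_dim (\<Lambda> ` {1..n}) \<le> 2 * CARD('m)"
    using aff_dim_le_DIM[of "\<Lambda> ` {1..n}"] by simp
  then have cardS: "card S \<le> 2 * CARD('m) + 1"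
    using S(3) by linarith
  \<comment> \<open>Caratheodory applied to \<open>S\<close> itself: the resulting set has at most
    \<open>aff_dim S + 1\<close> points but still more than \<open>2m\<close>, so
    \<open>aff_dim S\<close> is as large as \<open>card S\<close> permits.\<close>
  obtain S' where S': "finite S'" "S' \<subseteq> S" "card S' \<le> aff_dim S + 1" "0 \<in> convex hull S'"
    using S(4) unfolding caratheodory_aff_dim[of S] by blast
  have "2 * CARD('m) < card S'"
    using large[of S'] S S' by auto
  then have "aff_dim S = int (card S) - 1"
    using S' cardS aff_dim_le_card[OF S(1)] by linarith
  then have indep: "\<not> affine_dependent S"
    using S(1) affine_independent_iff_card by blast
  obtain I where I: "I \<subseteq> {1..n}" "inj_on \<Lambda> I" "S = \<Lambda> ` I"
    using S(2) by (meson subset_image_inj)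
  have "indispensable n \<Lambda> \<subseteq> I"
  proof
    fix a assume a: "a \<in> indispensable n \<Lambda>"
    show "a \<in> I"
    proof (rule ccontr)
      assume "a \<notin> I"
      then have "convex hull S \<subseteq> convex hull (\<Lambda> ` ({1..n} - {a}))"
        using I by (intro hull_mono) auto
      then show False
        using S a by (auto simp: indispensable_def)
    qed
  qed
  then show ?thesis
    using I indep by (meson affine_independent_subset image_mono inj_on_subset)
qed

lemma dim_differences_indispensable:
  fixes \<Lambda> :: "nat \<Rightarrow> complex ^ 'm"
  assumes "admissible n \<Lambda>" "minimally_stable n \<Lambda>"
  shows "dim (differences \<Lambda> (indispensable n \<Lambda>)) = CARD('m)"
proof -
  have "card (indispensable n \<Lambda>) = CARD('m) + 1"
    using assms(2) by (simp add: minimally_stable_def)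
  moreover from this have "finite (indispensable n \<Lambda>)" "indispensable n \<Lambda> \<noteq> {}"
    by (auto intro: card_ge_0_finite)
  ultimately show ?thesis
    using dim_differences_affine_independent[of "indispensable n \<Lambda>" \<Lambda>]
      affine_independent_indispensable[OF assms(1)] by auto
qed

section \<open>Real spans against complex spans\<close>

lemma scaleR_eq_vector_smult: "r *\<^sub>R (v :: complex ^ 'm) = complex_of_real r *s v"
  by (simp add: vec_eq_iff complex_eq_iff)

lemma span_subset_complex_span: "span S \<subseteq> vec.span (S :: (complex ^ 'm) set)"
  by (intro span_minimal vec.span_superset)
    (simp add: subspace_def vec.span_zero vec.span_add vec.span_scale scaleR_eq_vector_smult)

text \<open>The right-hand side is closed under multiplication by the imaginary unit, since doing
  this twice only changes the sign. Hence it is a complex subspace containing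
  \<open>S\<close>.\<close>

lemma complex_span_subset_span: "vec.span S \<subseteq> span (S \<union> (*s) \<i> ` (S :: (complex ^ 'm) set))"
proof -
  let ?T = "span (S \<union> (*s) \<i> ` S)"
  have i: "\<i> *s v \<in> ?T" if "v \<in> ?T" for v
    using that
  proof (induction rule: span_induct_alt)
    case base
    show ?case by (simp add: span_zero)
  next
    case (step c x y)
    have "\<i> *s x \<in> ?T"
      using step(1)
    proof
      assume "x \<in> (*s) \<i> ` S"
      then obtain z where z: "z \<in> S" "x = \<i> *s z" by blast
      then have "\<i> *s x = - z"
        by (simp add: vec_eq_iff)
      then show ?thesis
        using z by (simp add: span_neg span_base)
    qed (simp add: span_base)
    moreover have "\<i> *s (c *\<^sub>R x + y) = c *\<^sub>R (\<i> *s x) + \<i> *s y"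
      by (simp add: vec_eq_iff algebra_simps)
    ultimately show ?case
      using step by (simp add: span_add span_scale)
  qed
  have "c *s v \<in> ?T" if "v \<in> ?T" for c v
  proof -
    have "c *s v = Re c *\<^sub>R v + Im c *\<^sub>R (\<i> *s v)"
      by (simp add: vec_eq_iff complex_eq_iff)
    then show ?thesis
      using that i by (simp add: span_add span_scale)
  qed
  then have "vec.subspace ?T"
    by (simp add: vec.subspace_def span_zero span_add)
  then show ?thesis
    by (intro vec.span_minimal) (auto intro: span_base)
qed

text \<open>A complex basis and its multiples by the imaginary unit together have a real span
  containing \<open>S\<close>.\<close>

lemma dim_le_twice_complex_dim: "dim S \<le> 2 * vec.dim (S :: (complex ^ 'm) set)"
proof -
  obtain E where E: "E \<subseteq> S" "vec.independent E" "S \<subseteq> vec.span E" "card E = vec.dim S"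
    using vec.basis_exists by blast
  have fin: "finite E"
    using E(2) by (rule vec.finiteI_independent)
  have "dim S \<le> card (E \<union> (*s) \<i> ` E)"
    by (rule dim_le_card) (use E complex_span_subset_span[of E] fin in auto)
  also have "\<dots> \<le> card E + card ((*s) \<i> ` E)"
    by (rule card_Un_le)
  also have "\<dots> \<le> 2 * card E"
    using card_image_le[OF fin, of "(*s) \<i>"] by simp
  finally show ?thesis
    using E(4) by simp
qed

section \<open>Real automorphisms with prescribed complex dimension of an image\<close>

text \<open>\<open>A\<close> is only real linear and does not transport complex spans. A real
  spanning set still suffices, because real spans lie inside complex ones.\<close>

lemma complex_dim_real_linear_image:
  fixes A :: "complex ^ 'm \<Rightarrow> complex ^ 'm"
  assumes "linear A" "E \<subseteq> S" "S \<subseteq> span E"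
  shows "vec.dim (A ` S) = vec.dim (A ` E)"
proof (rule antisym)
  have "A ` S \<subseteq> span (A ` E)"
    using assms by (metis image_mono linear_span_image)
  then show "vec.dim (A ` S) \<le> vec.dim (A ` E)"
    using span_subset_complex_span by (intro vec.dim_mono) blast
qed (use assms in \<open>auto intro!: vec.dim_subset\<close>)

lemma complex_independent_axes:
  "vec.independent ((\<lambda>k. axis k 1 :: complex ^ 'm) ` K)"
proof (rule vec.independent_mono)
  show "vec.independent (cart_basis :: (complex ^ 'm) set)"
    by (rule independent_cart_basis)
qed (auto simp: cart_basis_def)

text \<open>Take \<open>r\<close> axes, and multiply \<open>m - r\<close> of them by the imaginary
  unit to get the missing real directions without enlarging the complex span. There are enough axes
  because \<open>m \<le> 2r\<close>.\<close>

lemma exists_independent_of_complex_dim: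
  assumes "CARD('m) \<le> 2 * r" "r \<le> CARD('m)"
  obtains C :: "(complex ^ 'm) set"
  where "independent C" "card C = CARD('m)" "vec.dim C = r"
proof -
  obtain K where K: "card K = r" "K \<subseteq> (UNIV :: 'm set)"
    using assms(2) by (metis obtain_subset_with_card_n)
  obtain L where L: "card L = CARD('m) - r" "L \<subseteq> K"
    using assms(1) K by (metis obtain_subset_with_card_n diff_le_mono mult_2 diff_add_inverse2)
  define X where "X = (\<lambda>k. axis k 1 :: complex ^ 'm) ` K"
  define Y where "Y = (\<lambda>k. axis k \<i> :: complex ^ 'm) ` L"
  have "card X = r" "card Y = CARD('m) - r"
    unfolding X_def Y_def using K L
    by (auto simp: card_image inj_on_def axis_eq_axis)
  moreover have "X \<inter> Y = {}"
    by (auto simp: X_def Y_def axis_eq_axis)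
  moreover have fin: "finite X" "finite Y"
    by (auto simp: X_def Y_def)
  ultimately have "card (X \<union> Y) = CARD('m)"
    using assms by (simp add: card_Un_disjoint)
  \<comment> \<open>The real \<open>Basis\<close> holds both the axes with entry \<open>1\<close>
    and those with the imaginary unit as entry.\<close>
  moreover have "X \<union> Y \<subseteq> Basis"
    by (auto simp: X_def Y_def Basis_complex_def)
  then have "independent (X \<union> Y)"
    using independent_Basis independent_mono by blast
  moreover have "vec.dim (X \<union> Y) = r"
  proof -
    have "axis k \<i> \<in> vec.span X" if "k \<in> L" for k
    proof -
      have "axis k 1 \<in> X"
        using that L by (auto simp: X_def)
      then have "\<i> *s axis k 1 \<in> vec.span X"
        by (intro vec.span_scale vec.span_base)
      moreover have "\<i> *s axis k 1 = (axis k \<i> :: complex ^ 'm)"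
        by (simp add: vec_eq_iff axis_def)
      ultimately show ?thesis
        by simp
    qed
    then have "X \<union> Y \<subseteq> vec.span X"
      by (auto simp: Y_def intro: vec.span_base)
    then have "vec.dim (X \<union> Y) = vec.dim X"
      by (metis Un_upper1 vec.dim_mono vec.dim_subset le_antisym)
    then show ?thesis
      using \<open>card X = r\<close> vec.dim_eq_card_independent[OF complex_independent_axes[of K]]
      by (simp add: X_def)
  qed
  ultimately show thesis
    using that by blast
qed

text \<open>A real basis of \<open>S\<close> is matched with an independent set of complex dimension
  \<open>r\<close>, and the matching extends to an injective real linear map.\<close>

lemma exists_automorphism_complex_dim:
  fixes S :: "(complex ^ 'm) set"
  assumes "dim S = CARD('m)" "CARD('m) \<le> 2 * r" "r \<le> CARD('m)"
  obtains A :: "complex ^ 'm \<Rightarrow> complex ^ 'm"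
  where "linear A" "inj A" "vec.dim (A ` S) = r"
proof -
  obtain C :: "(complex ^ 'm) set"
    where C: "independent C" "card C = CARD('m)" "vec.dim C = r"
    using exists_independent_of_complex_dim[OF assms(2,3)] .
  obtain E where E: "E \<subseteq> S" "independent E" "S \<subseteq> span E" "card E = CARD('m)"
    using basis_exists[of S] assms(1) by metis
  obtain f where f: "bij_betw f E C"
    using E C by (metis finiteI_independent finite_same_card_bij)
  then have "independent (f ` E)" "inj_on f E"
    using C by (auto simp: bij_betw_def)
  then obtain A where A: "linear A" "inj A" "\<forall>x\<in>E. A x = f x"
    using eucl.linear_independent_extend_inj[of E f] E(2) by blast
  have "A ` E = C"
    using A f by (auto simp: bij_betw_def)
  then show thesis
    using that[OF A(1,2)] complex_dim_real_linear_image[OF A(1) E(1,3)] C by simp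
qed

section \<open>Notions determined by the hulls that contain zero\<close>

text \<open>Linear maps commute with convex hulls, and injectivity lets only \<open>0\<close> reach
  \<open>0\<close>.\<close>

lemma zero_in_hull_inj_linear_image:
  fixes A :: "'a::real_vector \<Rightarrow> 'b::real_vector"
  assumes "linear A" "inj A"
  shows "0 \<in> convex hull ((A \<circ> \<Lambda>) ` I) \<longleftrightarrow> 0 \<in> convex hull (\<Lambda> ` I)"
proof -
  have "convex hull ((A \<circ> \<Lambda>) ` I) = A ` (convex hull (\<Lambda> ` I))"
    using assms(1) by (metis convex_hull_linear_image image_comp)
  then show ?thesis
    using assms by (metis (no_types) inj_image_mem_iff linear_0)
qed

text \<open>All the notions involved except the block see a configuration only through the label
  sets whose hull contains \<open>0\<close>.\<close>

locale same_zero_hulls =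
  fixes n :: nat and \<Lambda> \<Lambda>' :: "nat \<Rightarrow> complex ^ 'm"
  assumes same: "I \<subseteq> {1..n} \<Longrightarrow> 0 \<in> convex hull (\<Lambda>' ` I) \<longleftrightarrow> 0 \<in> convex hull (\<Lambda> ` I)"
begin

lemma admissible: "admissible n \<Lambda>' \<longleftrightarrow> admissible n \<Lambda>"
  by (auto simp: admissible_def same)

lemma indispensable: "indispensable n \<Lambda>' = indispensable n \<Lambda>"
  by (auto simp: indispensable_def same)

lemma visible: "visible n \<Lambda>' = visible n \<Lambda>"
  by (simp add: visible_def indispensable)

lemma minimally_stable: "minimally_stable n \<Lambda>' \<longleftrightarrow> minimally_stable n \<Lambda>"
  by (simp add: minimally_stable_def indispensable)

lemma visible_complex: "visible_complex n \<Lambda>' = visible_complex n \<Lambda>"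
  by (auto simp: visible_complex_def visible same)

lemma polytopal: "polytopal n \<Lambda>' \<longleftrightarrow> polytopal n \<Lambda>"
  by (simp add: polytopal_def visible_complex visible)

end

section \<open>Bounds on the rank and their realisation\<close>

lemma rank_indispensable_block_bounds:
  fixes \<Lambda> :: "nat \<Rightarrow> complex ^ 'm"
  assumes "admissible n \<Lambda>" "minimally_stable n \<Lambda>" "orders_indispensable n \<Lambda> a"
  shows "CARD('m) \<le> 2 * rank (indispensable_block \<Lambda> a)"
    and "rank (indispensable_block \<Lambda> a) \<le> CARD('m)"
  using dim_le_twice_complex_dim[of "differences \<Lambda> (indispensable n \<Lambda>)"]
    dim_subset_UNIV_cart_gen[of "differences \<Lambda> (indispensable n \<Lambda>)"]
  unfolding rank_indispensable_block[OF assms(3)] dim_differences_indispensable[OF assms(1,2)]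
  by auto

text \<open>Composing with a real automorphism keeps every hull condition while changing the complex
  span of the differences.\<close>

lemma exists_configuration_of_rank:
  fixes \<Lambda> :: "nat \<Rightarrow> complex ^ 'm"
  assumes "admissible n \<Lambda>" "minimally_stable n \<Lambda>" "CARD('m) \<le> 2 * r" "r \<le> CARD('m)"
  obtains \<Lambda>' :: "nat \<Rightarrow> complex ^ 'm"
  where "same_zero_hulls n \<Lambda> \<Lambda>'"
    "\<And>a. orders_indispensable n \<Lambda>' a \<Longrightarrow> rank (indispensable_block \<Lambda>' a) = r"
proof -
  let ?S = "differences \<Lambda> (indispensable n \<Lambda>)"
  obtain A :: "complex ^ 'm \<Rightarrow> complex ^ 'm"
    where A: "linear A" "inj A" "vec.dim (A ` ?S) = r"
    using exists_automorphism_complex_dim[OF dim_differences_indispensable[OF assms(1,2)] assms(3,4)] .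
  have same: "same_zero_hulls n \<Lambda> (A \<circ> \<Lambda>)"
    by unfold_locales (rule zero_in_hull_inj_linear_image[OF A(1,2)])
  have "differences (A \<circ> \<Lambda>) D = A ` differences \<Lambda> D" for D
    by (force simp: differences_def linear_diff[OF A(1)])
  then have "rank (indispensable_block (A \<circ> \<Lambda>) a) = r"
    if "orders_indispensable n (A \<circ> \<Lambda>) a" for a
    using rank_indispensable_block[OF that] A(3) same_zero_hulls.indispensable[OF same] by simp
  then show thesis
    using that same by blast
qed

text \<open>Ensures that assertions about all orderings are not vacuous.\<close>

lemma exists_orders_indispensable:
  fixes \<Lambda> :: "nat \<Rightarrow> complex ^ 'm"
  assumes "minimally_stable n \<Lambda>"
  obtains a where "orders_indispensable n \<Lambda> a"
proof -
  have "card (UNIV :: 'm option set) = card (indispensable n \<Lambda>)"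
    using assms by (simp add: minimally_stable_def card_UNIV_option)
  moreover have "finite (indispensable n \<Lambda>)"
    by (simp add: indispensable_def)
  ultimately show thesis
    using that by (metis finite finite_same_card_bij orders_indispensable_def)
qed

section \<open>A simplex around the origin and a minimally stable configuration\<close>

text \<open>The extra vertex is chosen so that the barycentre is \<open>0\<close>.\<close>

definition simplex_vertices :: "'a::euclidean_space set" where
  "simplex_vertices = insert (- \<Sum>Basis) Basis"

lemma inner_sum_Basis_left: "b \<in> Basis \<Longrightarrow> \<Sum>Basis \<bullet> (b :: 'a::euclidean_space) = 1"
  by (simp add: inner_sum_left inner_Basis)

lemma card_simplex_vertices: "card (simplex_vertices :: 'a::euclidean_space set) = DIM('a) + 1"
proof -
  have "- \<Sum>Basis \<notin> (Basis :: 'a set)"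
  proof
    assume *: "- \<Sum>Basis \<in> (Basis :: 'a set)"
    \<comment> \<open>The left side is minus a squared norm, so it cannot be
      \<open>1\<close>.\<close>
    then have "\<Sum>Basis \<bullet> (- \<Sum>Basis :: 'a) = 1"
      by (rule inner_sum_Basis_left)
    then show False
      using inner_ge_zero[of "\<Sum>Basis :: 'a"] by (simp del: inner_ge_zero)
  qed
  then show ?thesis
    by (simp add: simplex_vertices_def)
qed

lemma zero_in_hull_simplex_vertices:
  "0 \<in> convex hull (simplex_vertices :: 'a::euclidean_space set)"
proof -
  let ?S = "simplex_vertices :: 'a set"
  have fin: "finite ?S"
    by (simp add: simplex_vertices_def)
  \<comment> \<open>Were the extra vertex in \<open>Basis\<close>, inserting it would not raise the
    cardinality to \<open>DIM + 1\<close>.\<close>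
  have nin: "- \<Sum>Basis \<notin> (Basis :: 'a set)"
    using card_simplex_vertices[where 'a='a] by (auto simp: simplex_vertices_def insert_absorb)
  then have "\<Sum>?S = 0"
    by (simp add: simplex_vertices_def)
  then have "(\<Sum>x\<in>?S. (1 / real (card ?S)) *\<^sub>R x) = 0"
    by (simp flip: scaleR_sum_right)
  moreover have "(\<Sum>x\<in>?S. (1 / real (card ?S)) *\<^sub>R x) \<in> convex hull ?S"
    by (rule convex_sum) (use fin in \<open>auto simp: card_simplex_vertices hull_inc\<close>)
  ultimately show ?thesis
    by simp
qed

text \<open>Once a vertex is missing, some linear functional is at least \<open>1\<close> on all the
  others and separates them from \<open>0\<close>.\<close>

lemma zero_notin_hull_proper_subset:
  fixes X :: "'a::euclidean_space set"
  assumes "X \<subset> simplex_vertices"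
  shows "0 \<notin> convex hull X"
proof -
  obtain w where w: "\<And>x. x \<in> X \<Longrightarrow> w \<bullet> x \<ge> 1"
  proof (cases "- \<Sum>Basis \<in> X")
    case True
    then obtain b where b: "b \<in> Basis" "b \<notin> X"
      using assms by (auto simp: simplex_vertices_def)
    \<comment> \<open>This functional is \<open>1\<close> on \<open>- \<Sum>Basis\<close> and on
      every basis vector except \<open>b\<close>, where it is negative.\<close>
    let ?w = "\<Sum>Basis - (real DIM('a) + 1) *\<^sub>R b"
    have "?w \<bullet> x \<ge> 1" if "x \<in> X" for x
    proof (cases "x \<in> Basis")
      case True
      then show ?thesis
        using b that by (auto simp: inner_diff_left inner_sum_Basis_left inner_Basis)
    next
      case False
      then have x: "x = - \<Sum>Basis"
        using assms that by (auto simp: simplex_vertices_def)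
      have "\<Sum>Basis \<bullet> (\<Sum>Basis :: 'a) = (\<Sum>c\<in>Basis. \<Sum>Basis \<bullet> (c :: 'a))"
        by (simp add: inner_sum_right)
      also have "\<dots> = real DIM('a)"
        by (simp add: inner_sum_Basis_left)
      finally show ?thesis
        using b by (simp add: x inner_diff_left inner_commute[of b] inner_sum_Basis_left)
    qed
    then show thesis
      by (rule that)
  next
    case False
    then have "X \<subseteq> Basis"
      using assms by (auto simp: simplex_vertices_def)
    then show thesis
      using that[of "\<Sum>Basis"] inner_sum_Basis_left by (metis order_refl subsetD)
  qed
  then have "convex hull X \<subseteq> {x. w \<bullet> x \<ge> 1}"
    by (intro hull_minimal convex_halfspace_ge) auto
  then show ?thesis
    by auto
qed

text \<open>The vertices of a \<open>2m\<close>-simplex around \<open>0\<close>, with \<open>m\<close> of them taken twice.\<close>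

lemma exists_admissible_minimally_stable:
  obtains \<Lambda> :: "nat \<Rightarrow> complex ^ 'm" and n where "admissible n \<Lambda>" "minimally_stable n \<Lambda>"
proof -
  let ?m = "CARD('m)" and ?S = "simplex_vertices :: (complex ^ 'm) set"
  let ?k = "2 * ?m + 1" and ?n = "3 * ?m + 1"
  have fin: "finite ?S"
    by (simp add: simplex_vertices_def)
  have card: "card ?S = ?k"
    by (simp add: card_simplex_vertices)
  then obtain v where v: "bij_betw v {1..?k} ?S"
    using fin by (metis card_atLeastAtMost diff_Suc_1 finite_atLeastAtMost finite_same_card_bij)
  \<comment> \<open>Labels above \<open>2m + 1\<close> repeat the vertices with labels
    \<open>1\<close> to \<open>m\<close>; the other \<open>m + 1\<close> vertices occur
    once.\<close>
  define \<Lambda> where "\<Lambda> i = (if i \<le> ?k then v i else v (i - ?k))" for i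
  have low: "\<Lambda> i = v i" if "i \<in> {1..?k}" for i
    using that by (simp add: \<Lambda>_def)
  have vS: "v i \<in> ?S" if "i \<in> {1..?k}" for i
    using v that by (auto simp: bij_betw_def)
  have sub: "\<Lambda> i \<in> ?S" if "i \<in> {1..?n}" for i
  proof (cases "i \<le> ?k")
    case True
    then show ?thesis
      using that vS[of i] by (simp add: \<Lambda>_def)
  next
    case False
    then have "i - ?k \<in> {1..?k}"
      using that by auto
    then show ?thesis
      using False vS by (simp add: \<Lambda>_def)
  qed
  have iff: "0 \<in> convex hull (\<Lambda> ` I) \<longleftrightarrow> ?S \<subseteq> \<Lambda> ` I" if "I \<subseteq> {1..?n}" for I
  proof -
    have "\<Lambda> ` I \<subseteq> ?S"
      using that sub by blast
    then show ?thesis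
      using zero_notin_hull_proper_subset[of "\<Lambda> ` I"] zero_in_hull_simplex_vertices
      by (metis psubsetI subset_antisym)
  qed
  have S: "?S = \<Lambda> ` {1..?k}"
    using v image_cong[OF refl low, of "{1..?k}"] by (simp add: bij_betw_def)
  have "admissible ?n \<Lambda>"
  proof -
    have "?S \<subseteq> \<Lambda> ` {1..?n}"
      unfolding S by (intro image_mono) auto
    moreover have "\<not> ?S \<subseteq> \<Lambda> ` I" if "I \<subseteq> {1..?n}" "card I \<le> 2 * ?m" for I
    proof
      assume "?S \<subseteq> \<Lambda> ` I"
      moreover have "finite I"
        using that(1) finite_subset by blast
      ultimately have "card ?S \<le> card I"
        by (metis surj_card_le)
      then show False
        using card that by simp
    qed
    ultimately show ?thesis
      using iff by (auto simp: admissible_def)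
  qed
  moreover have "indispensable ?n \<Lambda> = {?m + 1..?k}"
  proof -
    \<comment> \<open>Removing a label loses a vertex exactly when no second label carries that
      vertex.\<close>
    have "?S \<subseteq> \<Lambda> ` ({1..?n} - {a}) \<longleftrightarrow> a \<notin> {?m + 1..?k}" if a: "a \<in> {1..?n}" for a
    proof
      assume sup: "?S \<subseteq> \<Lambda> ` ({1..?n} - {a})"
      show "a \<notin> {?m + 1..?k}"
      proof
        assume a': "a \<in> {?m + 1..?k}"
        then have "v a \<in> \<Lambda> ` ({1..?n} - {a})"
          using sup vS[of a] by auto
        then obtain i where i: "i \<in> {1..?n}" "i \<noteq> a" "\<Lambda> i = v a"
          unfolding image_iff by (metis Diff_iff singletonI)
        have inj: "j = a" if "v j = v a" "j \<in> {1..?k}" for j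
        proof -
          have "a \<in> {1..?k}"
            using a' by simp
          then show ?thesis
            using inj_onD[OF bij_betw_imp_inj_on[OF v] that] by blast
        qed
        show False
        proof (cases "i \<le> ?k")
          case True
          then show False
            using i inj[of i] by (simp add: \<Lambda>_def)
        next
          case False
          then have "v (i - ?k) = v a" "i - ?k \<in> {1..?k}"
            using i(1,3) by (auto simp: \<Lambda>_def)
          then have "i - ?k = a"
            by (rule inj)
          moreover have "i - ?k \<le> ?m"
            using i(1) by auto
          ultimately show False
            using a' by simp
        qed
      qed
    next
      assume a': "a \<notin> {?m + 1..?k}"
      show "?S \<subseteq> \<Lambda> ` ({1..?n} - {a})"
      proof
        fix x assume "x \<in> ?S"
        then obtain i where i: "i \<in> {1..?k}" "x = \<Lambda> i"
          unfolding S by blast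
        show "x \<in> \<Lambda> ` ({1..?n} - {a})"
        proof (cases "i = a")
          case False
          then show ?thesis
            using i by auto
        next
          case True
          \<comment> \<open>Here \<open>a \<le> m\<close>, so the second copy has label
            \<open>a + 2m + 1 \<le> 3m + 1\<close>.\<close>
          then have "x = \<Lambda> (i + ?k)" "i + ?k \<in> {1..?n} - {a}"
            using i a' by (auto simp: \<Lambda>_def)
          then show ?thesis
            by blast
        qed
      qed
    qed
    then have "0 \<notin> convex hull (\<Lambda> ` ({1..?n} - {a})) \<longleftrightarrow> a \<in> {?m + 1..?k}"
      if "a \<in> {1..?n}" for a
      using that iff[of "{1..?n} - {a}"] by auto
    then have "indispensable ?n \<Lambda> = {a \<in> {1..?n}. a \<in> {?m + 1..?k}}"
      unfolding indispensable_def by blast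
    also have "\<dots> = {?m + 1..?k}"
    proof -
      have "?k \<le> ?n"
        by simp
      then show ?thesis
        by (intro set_eqI) auto
    qed
    finally show ?thesis .
  qed
  then have "minimally_stable ?n \<Lambda>"
    by (simp add: minimally_stable_def)
  ultimately show thesis
    using that by blast
qed

section \<open>The set of ranks that occur\<close>

lemma ceiling_half_le_iff: "\<lceil>real m / 2\<rceil> \<le> int r \<longleftrightarrow> m \<le> 2 * r"
  by (simp add: ceiling_le_iff) linarith

theorem theorem3p8:
  shows
    "(\<forall>n (\<Lambda> :: nat \<Rightarrow> complex ^ 'm).
        admissible n \<Lambda> \<and> minimally_stable n \<Lambda> \<longrightarrow>
          (\<forall>r::nat. \<lceil>real CARD('m) / 2\<rceil> \<le> int r \<and> r \<le> CARD('m) \<longrightarrow>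
             (\<exists>\<Lambda>r :: nat \<Rightarrow> complex ^ 'm.
                admissible n \<Lambda>r \<and> minimally_stable n \<Lambda>r \<and>
                (\<forall>I \<subseteq> {1..n}. 0 \<in> convex hull (\<Lambda>r ` I) \<longleftrightarrow> 0 \<in> convex hull (\<Lambda> ` I)) \<and>
                indispensable n \<Lambda>r = indispensable n \<Lambda> \<and>
                visible_complex n \<Lambda>r = visible_complex n \<Lambda> \<and>
                (\<forall>a. orders_indispensable n \<Lambda>r a \<longrightarrow> rank (indispensable_block \<Lambda>r a) = r) \<and>
                (polytopal n \<Lambda> \<longrightarrow> polytopal n \<Lambda>r))) \<and>
          {r. \<exists>(\<Lambda>' :: nat \<Rightarrow> complex ^ 'm) a.
                admissible n \<Lambda>' \<and> minimally_stable n \<Lambda>' \<and>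
                visible_complex n \<Lambda>' = visible_complex n \<Lambda> \<and>
                orders_indispensable n \<Lambda>' a \<and> rank (indispensable_block \<Lambda>' a) = r}
            = {r. \<lceil>real CARD('m) / 2\<rceil> \<le> int r \<and> r \<le> CARD('m)}) \<and>
     {r. \<exists>n (\<Lambda> :: nat \<Rightarrow> complex ^ 'm) a.
           admissible n \<Lambda> \<and> minimally_stable n \<Lambda> \<and>
           orders_indispensable n \<Lambda> a \<and> rank (indispensable_block \<Lambda> a) = r}
       = {r. \<lceil>real CARD('m) / 2\<rceil> \<le> int r \<and> r \<le> CARD('m)}"
proof (intro conjI allI impI)
  fix n and \<Lambda> :: "nat \<Rightarrow> complex ^ 'm" and r :: nat
  assume "admissible n \<Lambda> \<and> minimally_stable n \<Lambda>"
    and r: "\<lceil>real CARD('m) / 2\<rceil> \<le> int r \<and> r \<le> CARD('m)"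
  then have adm: "admissible n \<Lambda>" "minimally_stable n \<Lambda>"
    by auto
  obtain \<Lambda>' :: "nat \<Rightarrow> complex ^ 'm" where same: "same_zero_hulls n \<Lambda> \<Lambda>'"
    and rank: "\<And>a. orders_indispensable n \<Lambda>' a \<Longrightarrow> rank (indispensable_block \<Lambda>' a) = r"
    using exists_configuration_of_rank[OF adm, of r] r unfolding ceiling_half_le_iff by blast
  interpret same_zero_hulls n \<Lambda> \<Lambda>'
    by (fact same)
  show "\<exists>\<Lambda>r :: nat \<Rightarrow> complex ^ 'm.
                admissible n \<Lambda>r \<and> minimally_stable n \<Lambda>r \<and>
                (\<forall>I \<subseteq> {1..n}. 0 \<in> convex hull (\<Lambda>r ` I) \<longleftrightarrow> 0 \<in> convex hull (\<Lambda> ` I)) \<and>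
                indispensable n \<Lambda>r = indispensable n \<Lambda> \<and>
                visible_complex n \<Lambda>r = visible_complex n \<Lambda> \<and>
                (\<forall>a. orders_indispensable n \<Lambda>r a \<longrightarrow> rank (indispensable_block \<Lambda>r a) = r) \<and>
                (polytopal n \<Lambda> \<longrightarrow> polytopal n \<Lambda>r)"
    using adm rank same admissible minimally_stable indispensable visible_complex polytopal
    by (intro exI[of _ \<Lambda>']) auto
next
  \<comment> \<open>Common to both set equalities: it gives the inclusion from the interval into the
    set of ranks, while the rank bounds give the other inclusion.\<close>
  have realised: "\<exists>(\<Lambda>' :: nat \<Rightarrow> complex ^ 'm) a. admissible n \<Lambda>' \<and> minimally_stable n \<Lambda>' \<and>
      visible_complex n \<Lambda>' = visible_complex n \<Lambda> \<and>
      orders_indispensable n \<Lambda>' a \<and> rank (indispensable_block \<Lambda>' a) = r"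
    if stable: "admissible n \<Lambda>" "minimally_stable n \<Lambda>" "CARD('m) \<le> 2 * r" "r \<le> CARD('m)"
    for n and \<Lambda> :: "nat \<Rightarrow> complex ^ 'm" and r
  proof -
    obtain \<Lambda>' :: "nat \<Rightarrow> complex ^ 'm" where same: "same_zero_hulls n \<Lambda> \<Lambda>'"
      and rank: "\<And>a. orders_indispensable n \<Lambda>' a \<Longrightarrow> rank (indispensable_block \<Lambda>' a) = r"
      using exists_configuration_of_rank[OF stable] by blast
    interpret same_zero_hulls n \<Lambda> \<Lambda>'
      by (fact same)
    have "minimally_stable n \<Lambda>'"
      using stable minimally_stable by simp
    moreover from this obtain a where "orders_indispensable n \<Lambda>' a"
      by (rule exists_orders_indispensable)
    ultimately show ?thesis
      using stable rank admissible visible_complex by blast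
  qed
  {
    fix n and \<Lambda> :: "nat \<Rightarrow> complex ^ 'm"
    assume "admissible n \<Lambda> \<and> minimally_stable n \<Lambda>"
    then show "{r. \<exists>(\<Lambda>' :: nat \<Rightarrow> complex ^ 'm) a.
                admissible n \<Lambda>' \<and> minimally_stable n \<Lambda>' \<and>
                visible_complex n \<Lambda>' = visible_complex n \<Lambda> \<and>
                orders_indispensable n \<Lambda>' a \<and> rank (indispensable_block \<Lambda>' a) = r}
            = {r. \<lceil>real CARD('m) / 2\<rceil> \<le> int r \<and> r \<le> CARD('m)}"
      using realised[of n \<Lambda>] rank_indispensable_block_bounds[where 'm='m]
      unfolding ceiling_half_le_iff by blast
  }
  \<comment> \<open>The global equality starts from no given configuration, so one has to be
    supplied.\<close>
  obtain n and \<Lambda> :: "nat \<Rightarrow> complex ^ 'm" where "admissible n \<Lambda>" "minimally_stable n \<Lambda>"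
    using exists_admissible_minimally_stable .
  then show "{r. \<exists>n (\<Lambda> :: nat \<Rightarrow> complex ^ 'm) a.
           admissible n \<Lambda> \<and> minimally_stable n \<Lambda> \<and>
           orders_indispensable n \<Lambda> a \<and> rank (indispensable_block \<Lambda> a) = r}
       = {r. \<lceil>real CARD('m) / 2\<rceil> \<le> int r \<and> r \<le> CARD('m)}"
    using realised[of n \<Lambda>] rank_indispensable_block_bounds[where 'm='m]
    unfolding ceiling_half_le_iff by blast
qed

end
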